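(* Let $A$ be a finite skew brace which is left nilpotent and of nilpotent type (i.e. $(A,+)$ is a nilpotent group). Then each of the graphs $\Lambda(A)$ and $\Theta(A)$ is connected and has diameter at most $2$.
   Context: A skew brace is a triple $(A,+,\circ)$ where $(A,+)$ and $(A,\circ)$ are groups (same identity $0$) with $a\circ(b+c)=a\circ b-a+a\circ c$ for all $a,b,c\in A$. The map $\lambda\colon(A,\circ)\to\operatorname{Aut}(A,+)$, $\lambda_a(b)=-a+a\circ b$, is an action by automorphisms; $\theta$ is the action of the semidirect product $(A,+)\rtimes_\lambda(A,\circ)$ on $(A,+)$ given by $\theta_{(a,b)}(c)=a+\lambda_b(c)-a$. For $a,b\in A$ let $a*b=\lambda_a(b)-b$, and for subsets $X,Y$ let $X*Y$ be the additive subgroup generated by all $x*y$. Set $A^1=A$, $A^{n+1}=A*A^n$; $A$ is left nilpotent if $A^n=\{0\}$ for some $n$. For a finite skew brace, $\Lambda(A)$ (resp. $\Theta(A)$) is the graph whose vertices are the $\lambda$-orbits (resp. $\theta$-orbits) in $A$ of size $>1$, two distinct vertices $L_1,L_2$ being adjacent iff $\gcd(|L_1|,|L_2|)\ne 1$. *)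

theory Defs
  imports "HOL-Algebra.Algebra"
begin

definition lcs_step :: "('a, 'b) monoid_scheme \<Rightarrow> 'a set \<Rightarrow> 'a set" where
  "lcs_step G H = generate G
     { g \<otimes>\<^bsub>G\<^esub> h \<otimes>\<^bsub>G\<^esub> inv\<^bsub>G\<^esub> g \<otimes>\<^bsub>G\<^esub> inv\<^bsub>G\<^esub> h | g h. g \<in> carrier G \<and> h \<in> H }"

definition lower_central :: "('a, 'b) monoid_scheme \<Rightarrow> nat \<Rightarrow> 'a set" where
  "lower_central G n = (lcs_step G ^^ n) (carrier G)"

definition nilpotent_group :: "('a, 'b) monoid_scheme \<Rightarrow> bool" where
  "nilpotent_group G \<longleftrightarrow> group G \<and> (\<exists>n. lower_central G n = {\<one>\<^bsub>G\<^esub>})"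

text \<open>P is the additive group (A,+) (written with the HOL-Algebra multiplication),
  C is the group (A,\<circ>), on the same carrier with the same identity.\<close>

definition skew_brace :: "'a monoid \<Rightarrow> 'a monoid \<Rightarrow> bool" where
  "skew_brace P C \<longleftrightarrow> group P \<and> group C \<and> carrier C = carrier P \<and> \<one>\<^bsub>C\<^esub> = \<one>\<^bsub>P\<^esub> \<and>
     (\<forall>a\<in>carrier P. \<forall>b\<in>carrier P. \<forall>c\<in>carrier P.
        a \<otimes>\<^bsub>C\<^esub> (b \<otimes>\<^bsub>P\<^esub> c) = (a \<otimes>\<^bsub>C\<^esub> b) \<otimes>\<^bsub>P\<^esub> inv\<^bsub>P\<^esub> a \<otimes>\<^bsub>P\<^esub> (a \<otimes>\<^bsub>C\<^esub> c))"

definition sb_lambda :: "'a monoid \<Rightarrow> 'a monoid \<Rightarrow> 'a \<Rightarrow> 'a \<Rightarrow> 'a" where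
  "sb_lambda P C a b = inv\<^bsub>P\<^esub> a \<otimes>\<^bsub>P\<^esub> (a \<otimes>\<^bsub>C\<^esub> b)"

definition sb_star :: "'a monoid \<Rightarrow> 'a monoid \<Rightarrow> 'a \<Rightarrow> 'a \<Rightarrow> 'a" where
  "sb_star P C a b = sb_lambda P C a b \<otimes>\<^bsub>P\<^esub> inv\<^bsub>P\<^esub> b"

definition sb_star_set :: "'a monoid \<Rightarrow> 'a monoid \<Rightarrow> 'a set \<Rightarrow> 'a set \<Rightarrow> 'a set" where
  "sb_star_set P C S T = generate P { sb_star P C s t | s t. s \<in> S \<and> t \<in> T }"

text \<open>left_series P C n = A^(n+1): A^1 = A, A^(n+1) = A * A^n\<close>
fun left_series :: "'a monoid \<Rightarrow> 'a monoid \<Rightarrow> nat \<Rightarrow> 'a set" where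
  "left_series P C 0 = carrier P"
| "left_series P C (Suc n) = sb_star_set P C (carrier P) (left_series P C n)"

definition left_nilpotent :: "'a monoid \<Rightarrow> 'a monoid \<Rightarrow> bool" where
  "left_nilpotent P C \<longleftrightarrow> (\<exists>n. left_series P C n = {\<one>\<^bsub>P\<^esub>})"

definition lambda_orbit :: "'a monoid \<Rightarrow> 'a monoid \<Rightarrow> 'a \<Rightarrow> 'a set" where
  "lambda_orbit P C b = { sb_lambda P C a b | a. a \<in> carrier C }"

definition theta_orbit :: "'a monoid \<Rightarrow> 'a monoid \<Rightarrow> 'a \<Rightarrow> 'a set" where
  "theta_orbit P C c = { a \<otimes>\<^bsub>P\<^esub> sb_lambda P C b c \<otimes>\<^bsub>P\<^esub> inv\<^bsub>P\<^esub> a | a b. a \<in> carrier P \<and> b \<in> carrier C }"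

definition orbit_vertices :: "'a set \<Rightarrow> ('a \<Rightarrow> 'a set) \<Rightarrow> 'a set set" where
  "orbit_vertices A orb = { L. \<exists>x\<in>A. L = orb x \<and> card L > 1 }"

definition orbit_adj :: "'a set \<Rightarrow> 'a set \<Rightarrow> bool" where
  "orbit_adj L1 L2 \<longleftrightarrow> L1 \<noteq> L2 \<and> gcd (card L1) (card L2) \<noteq> 1"

definition graph_connected :: "'v set \<Rightarrow> ('v \<Rightarrow> 'v \<Rightarrow> bool) \<Rightarrow> bool" where
  "graph_connected V E \<longleftrightarrow>
     (\<forall>x\<in>V. \<forall>y\<in>V. (\<lambda>u v. u \<in> V \<and> v \<in> V \<and> E u v)\<^sup>*\<^sup>* x y)"

definition diameter_le_2 :: "'v set \<Rightarrow> ('v \<Rightarrow> 'v \<Rightarrow> bool) \<Rightarrow> bool" where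
  "diameter_le_2 V E \<longleftrightarrow>
     (\<forall>x\<in>V. \<forall>y\<in>V. x \<noteq> y \<longrightarrow> E x y \<or> (\<exists>z\<in>V. E x z \<and> E z y))"

abbreviation Lambda_graph_V :: "'a monoid \<Rightarrow> 'a monoid \<Rightarrow> 'a set set" where
  "Lambda_graph_V P C \<equiv> orbit_vertices (carrier P) (lambda_orbit P C)"

abbreviation Theta_graph_V :: "'a monoid \<Rightarrow> 'a monoid \<Rightarrow> 'a set set" where
  "Theta_graph_V P C \<equiv> orbit_vertices (carrier P) (theta_orbit P C)"

end

theory Submission
  imports Defs
begin

text \<open>
  Left nilpotency makes the image of the circle group in the automorphism group of the additive
  Sylow p-subgroup a p-group: if g has order a power of q and x is a p-element with p different
  from q, then, by induction down the left series, g fixes b = g(x) - x, so that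
  g^k(x) = k b + x for all k and b = 0. Moreover the q-elements of the nilpotent additive group
  commute with x. Hence the stabilizer of x, in the circle group or in the semidirect product,
  contains a Sylow q-subgroup, and the orbit of x has size prime to q.

  If an element x is moved, some power of x that is a p-element is moved, and the size of the
  orbit of that power divides the size of the orbit of x. Given two orbits of coprime sizes, we
  obtain in this way a moved p-element a and a moved q-element b with p and q distinct. Both are
  powers of a + b, so the size of the orbit of a + b is divisible by p and q, and this orbit is
  adjacent to both given ones.
\<close>

section \<open>Finite nilpotent groups\<close>

text \<open>In a finite nilpotent group this set turns out to be the unique Sylow p-subgroup.
  Describing it by exponents makes its invariance under automorphisms immediate.\<close>

definition p_elements :: "('a, 'b) monoid_scheme \<Rightarrow> nat \<Rightarrow> 'a set" where
  "p_elements G p = {x \<in> carrier G. \<exists>k. x [^]\<^bsub>G\<^esub> (p ^ k) = \<one>\<^bsub>G\<^esub>}"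

section \<open>Coprime exponents and commutators\<close>

context group
begin

text \<open>By Bezout, the power with exponent \<open>gcd i j\<close> is a quotient of powers of
  \<open>x [^] i\<close> and \<open>x [^] j\<close>. Coprimality enters the development through this
  fact, with \<open>H\<close> a fixed-point group, a term of the lower central series, a Sylow
  subgroup or the trivial group.\<close>

lemma pow_gcd_mem:
  fixes i j :: nat
  assumes H: "subgroup H G" and x: "x \<in> carrier G" and i: "x [^] i \<in> H" and j: "x [^] j \<in> H"
  shows "x [^] gcd i j \<in> H"
proof (cases "i = 0")
  case True
  then show ?thesis using j by simp
next
  case False
  have pow: "h [^] (n::nat) \<in> H" if "h \<in> H" for h n
    using that H by (induction n) (auto simp: subgroup.one_closed subgroup.m_closed)
  \<comment> \<open>Bezout coefficients in the natural numbers put the gcd on one side only, which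
    is why \<open>i = 0\<close> was split off.\<close>
  obtain u v where uv: "i * u = j * v + gcd i j"
    using bezout_nat[OF False] by blast
  have "x [^] (i * u) \<in> H" "x [^] (j * v) \<in> H"
    using pow[OF i, of u] pow[OF j, of v] x by (simp_all add: nat_pow_pow)
  moreover have "x [^] (i * u) = x [^] (j * v) \<otimes> x [^] gcd i j"
    using x by (simp add: uv nat_pow_mult)
  ultimately have "inv (x [^] (j * v)) \<otimes> (x [^] (j * v) \<otimes> x [^] gcd i j) \<in> H"
    using H by (metis subgroup.m_closed subgroup.m_inv_closed)
  then show ?thesis
    using x by (simp add: m_assoc[symmetric])
qed

lemma pow_coprime_mem:
  fixes i j :: nat
  assumes "subgroup H G" "x \<in> carrier G" "x [^] i \<in> H" "x [^] j \<in> H" "coprime i j"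
  shows "x \<in> H"
  using pow_gcd_mem[OF assms(1-4)] assms(2,5) by simp

lemma p_elements_closed: "x \<in> p_elements G p \<Longrightarrow> x \<in> carrier G"
  by (simp add: p_elements_def)

lemma p_subgroup_subset_p_elements:
  assumes H: "subgroup H G" and card: "card H = p ^ a" and p: "Factorial_Ring.prime p"
  shows "H \<subseteq> p_elements G p"
proof
  fix x assume x: "x \<in> H"
  interpret H: group "G\<lparr>carrier := H\<rparr>"
    using H by (rule subgroup.subgroup_is_group) (rule is_group)
  have "finite H" using card p by (metis card.infinite power_not_zero not_prime_0)
  then have "x [^]\<^bsub>G\<lparr>carrier := H\<rparr>\<^esub> order (G\<lparr>carrier := H\<rparr>) = \<one>"
    using H.pow_order_eq_1 x by simp
  then have "x [^] (p ^ a) = \<one>"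
    using card by (simp add: order_def nat_pow_consistent[symmetric])
  then show "x \<in> p_elements G p"
    using x H by (auto simp: p_elements_def subgroup.mem_carrier)
qed

lemma p_element_coprime_pow_eq_one:
  assumes "x \<in> p_elements G p" "x [^] m = \<one>" "coprime p m"
  shows "x = \<one>"
proof -
  obtain k where "x [^] (p ^ k) = \<one>" "x \<in> carrier G" using assms(1) by (auto simp: p_elements_def)
  then have "x \<in> {\<one>}"
    using pow_coprime_mem[OF triv_subgroup, of x "p ^ k" m] assms(2,3) by simp
  then show ?thesis by simp
qed

text \<open>Modulo K the commutator c of x and y is central, so \<open>x\<^sup>k y = c\<^sup>k y x\<^sup>k\<close> modulo K.\<close>

lemma commutator_pow_mem:
  fixes m :: nat
  assumes H: "subgroup H G" and K: "subgroup K G" and KH: "K \<subseteq> H"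
    and comm: "\<And>g h. g \<in> carrier G \<Longrightarrow> h \<in> H \<Longrightarrow> g \<otimes> h \<otimes> inv g \<otimes> inv h \<in> K"
    and x: "x \<in> carrier G" and y: "y \<in> carrier G"
    and c: "x \<otimes> y \<otimes> inv x \<otimes> inv y \<in> H" and xm: "x [^] m = \<one>"
  shows "(x \<otimes> y \<otimes> inv x \<otimes> inv y) [^] m \<in> K"
proof -
  define c where "c = x \<otimes> y \<otimes> inv x \<otimes> inv y"
  have cH: "c \<in> H" using assms by (simp add: c_def)
  have cc: "c \<in> carrier G" using x y by (simp add: c_def)
  have powH: "c [^] (n::nat) \<in> H" for n
    using cH H by (induction n) (auto simp: subgroup.one_closed subgroup.m_closed)
  have xy: "x \<otimes> y = c \<otimes> y \<otimes> x"
    using x y by (simp add: c_def m_assoc)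
  have conjH: "\<exists>e\<in>K. x \<otimes> h = e \<otimes> h \<otimes> x" if "h \<in> H" for h
  proof
    show "x \<otimes> h \<otimes> inv x \<otimes> inv h \<in> K" using comm x that by blast
    show "x \<otimes> h = x \<otimes> h \<otimes> inv x \<otimes> inv h \<otimes> h \<otimes> x"
      using x subgroup.mem_carrier[OF H that] by (simp add: m_assoc)
  qed
  have "\<exists>e\<in>K. x [^] n \<otimes> y = e \<otimes> c [^] n \<otimes> y \<otimes> x [^] n" for n :: nat
  proof (induction n)
    case 0
    show ?case using subgroup.one_closed[OF K] y by force
  next
    case (Suc n)
    then obtain e where e: "e \<in> K" "x [^] n \<otimes> y = e \<otimes> c [^] n \<otimes> y \<otimes> x [^] n" by blast
    \<comment> \<open>Since \<open>K\<close> lies in \<open>H\<close>, the hypothesis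
      \<open>comm\<close> also moves \<open>x\<close> past \<open>e\<close>. All correction factors
      are collected at the far left, which takes the place of normality of \<open>K\<close>.\<close>
    obtain f where f: "f \<in> K" "x \<otimes> e = f \<otimes> e \<otimes> x" using conjH e KH by blast
    obtain d where d: "d \<in> K" "x \<otimes> c [^] n = d \<otimes> c [^] n \<otimes> x" using conjH powH by blast
    have cl: "e \<in> carrier G" "f \<in> carrier G" "d \<in> carrier G"
      using e f d K by (auto simp: subgroup.mem_carrier)
    have pow_Suc: "x [^] Suc n = x \<otimes> x [^] n"
      using x by (rule nat_pow_Suc2)
    have "x [^] Suc n \<otimes> y = x \<otimes> (x [^] n \<otimes> y)"
      unfolding pow_Suc using x y by (simp add: m_assoc)
    also have "\<dots> = (x \<otimes> e) \<otimes> c [^] n \<otimes> y \<otimes> x [^] n"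
      using e x y cl cc by (simp add: m_assoc)
    also have "\<dots> = f \<otimes> e \<otimes> (x \<otimes> c [^] n) \<otimes> y \<otimes> x [^] n"
      using f x y cl cc by (simp add: m_assoc)
    also have "\<dots> = f \<otimes> e \<otimes> d \<otimes> c [^] n \<otimes> (x \<otimes> y) \<otimes> x [^] n"
      using d x y cl cc by (simp add: m_assoc)
    also have "\<dots> = (f \<otimes> e \<otimes> d) \<otimes> c [^] Suc n \<otimes> y \<otimes> x [^] Suc n"
      unfolding pow_Suc xy using x y cl cc by (simp add: m_assoc)
    finally show ?case
      using e f d K by (meson subgroup.m_closed)
  qed
  \<comment> \<open>At \<open>n = m\<close> the powers of \<open>x\<close> vanish, so that
    \<open>e\<close> and the m-th power of \<open>c\<close> cancel.\<close>
  from this[of m] obtain e where e: "e \<in> K" "y = e \<otimes> c [^] m \<otimes> y"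
    using xm x y cc subgroup.mem_carrier[OF K] by auto
  have ec: "e \<in> carrier G" using e K by (simp add: subgroup.mem_carrier)
  have "e \<otimes> c [^] m = \<one>"
    using e(2) ec cc y by (metis l_cancel_one' m_closed nat_pow_closed r_cancel_one')
  then have "c [^] m = inv e"
    using ec cc by (metis inv_equality inv_inv nat_pow_closed)
  then show ?thesis using e K by (simp add: c_def subgroup.m_inv_closed)
qed

section \<open>Lower central series and commuting elements of coprime order\<close>

lemma lcs_step_subgroup:
  assumes "H \<subseteq> carrier G" shows "subgroup (lcs_step G H) G"
  unfolding lcs_step_def by (rule generate_is_subgroup) (use assms in auto)

lemma lower_central_subgroup: "subgroup (lower_central G n) G"
proof (induction n)
  case 0
  show ?case by (simp add: lower_central_def subgroup_self)
next
  case (Suc n)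
  then show ?case
    by (simp add: lower_central_def lcs_step_subgroup subgroup.subset)
qed

lemma lower_central_Suc: "lower_central G (Suc n) = lcs_step G (lower_central G n)"
  by (simp add: lower_central_def)

lemma commutator_mem_lower_central:
  assumes "g \<in> carrier G" "h \<in> lower_central G n"
  shows "g \<otimes> h \<otimes> inv g \<otimes> inv h \<in> lower_central G (Suc n)"
  unfolding lower_central_Suc lcs_step_def by (rule generate.incl) (use assms in auto)

lemma lower_central_antimono: "lower_central G (Suc n) \<subseteq> lower_central G n"
proof (induction n)
  case 0
  show ?case using subgroup.subset[OF lower_central_subgroup[of "Suc 0"]]
    by (simp add: lower_central_def)
next
  case (Suc n)
  show ?case
    unfolding lower_central_Suc[of "Suc n"] lower_central_Suc[of n]
    using Suc unfolding lcs_step_def by (intro mono_generate) (auto simp: lower_central_Suc lcs_step_def)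
qed

text \<open>The commutator \<open>c\<close> sinks through the lower central series: if it lies in
  one term, its powers with exponents \<open>m\<close> and \<open>n\<close> lie in the next, and by
  coprimality so does \<open>c\<close>. The series reaches the trivial group, hence \<open>c\<close>
  is trivial.\<close>

lemma nilpotent_coprime_commute:
  fixes m n :: nat
  assumes nil: "nilpotent_group G" and x: "x \<in> carrier G" and y: "y \<in> carrier G"
    and xm: "x [^] m = \<one>" and yn: "y [^] n = \<one>" and mn: "coprime m n"
  shows "x \<otimes> y = y \<otimes> x"
proof -
  define c where "c = x \<otimes> y \<otimes> inv x \<otimes> inv y"
  have cc: "c \<in> carrier G" using x y by (simp add: c_def)
  have inv_c: "inv c = y \<otimes> x \<otimes> inv y \<otimes> inv x"
    using x y by (simp add: c_def inv_mult_group m_assoc)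
  have "c \<in> lower_central G i" for i
  proof (induction i)
    case 0
    show ?case using cc by (simp add: lower_central_def)
  next
    case (Suc i)
    note sub = lower_central_subgroup[of i] lower_central_subgroup[of "Suc i"]
      lower_central_antimono[of i]
    have "c [^] m \<in> lower_central G (Suc i)"
      unfolding c_def
      by (rule commutator_pow_mem[OF sub commutator_mem_lower_central x y _ xm])
        (use Suc c_def in auto)
    \<comment> \<open>The inverse of \<open>c\<close> is the commutator of \<open>y\<close> and
      \<open>x\<close>, so the exponent \<open>n\<close> of \<open>y\<close> is handled by
      exchanging the roles of \<open>x\<close> and \<open>y\<close>.\<close>
    moreover have "inv c \<in> lower_central G i"
      using Suc sub by (simp add: subgroup.m_inv_closed)
    then have "inv c [^] n \<in> lower_central G (Suc i)"
      unfolding inv_c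
      by (intro commutator_pow_mem[OF sub commutator_mem_lower_central y x _ yn]) auto
    then have "inv (inv c [^] n) \<in> lower_central G (Suc i)"
      using sub by (simp add: subgroup.m_inv_closed)
    then have "c [^] n \<in> lower_central G (Suc i)"
      using cc by (simp add: nat_pow_inv)
    ultimately show ?case
      using pow_coprime_mem[OF sub(2) cc] mn by blast
  qed
  then have "c = \<one>"
    using nil unfolding nilpotent_group_def by blast
  then have "x \<otimes> y \<otimes> inv x \<otimes> inv y \<otimes> y \<otimes> x = y \<otimes> x"
    using x y by (simp add: c_def)
  then show ?thesis using x y by (simp add: m_assoc)
qed

lemma nilpotent_p_elements_commute:
  assumes "nilpotent_group G" "x \<in> p_elements G p" "y \<in> p_elements G q"
    and "Factorial_Ring.prime p" "Factorial_Ring.prime q" "p \<noteq> q"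
  shows "x \<otimes> y = y \<otimes> x"
proof -
  obtain i j where "x [^] (p ^ i) = \<one>" "y [^] (q ^ j) = \<one>" "x \<in> carrier G" "y \<in> carrier G"
    using assms by (auto simp: p_elements_def)
  then show ?thesis
    using nilpotent_coprime_commute[OF assms(1), of x y "p^i" "q^j"] primes_coprime[OF assms(4-6)]
    by simp
qed

section \<open>Sylow subgroups of finite nilpotent groups\<close>

lemma card_subgroup_dvd:
  assumes "subgroup H G" "subgroup K G" "H \<subseteq> K"
  shows "card H dvd card K"
proof -
  interpret K: group "G\<lparr>carrier := K\<rparr>"
    using assms(2) by (rule subgroup.subgroup_is_group) (rule is_group)
  have "subgroup H (G\<lparr>carrier := K\<rparr>)" using subgroup_incl assms by blast
  from K.lagrange[OF this] have "card (rcosets\<^bsub>G\<lparr>carrier := K\<rparr>\<^esub> H) * card H = card K"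
    by (simp add: order_def)
  then show ?thesis unfolding dvd_def by (metis mult.commute)
qed

lemma sylow_exists:
  assumes "finite (carrier G)" "Factorial_Ring.prime p"
  obtains P where "subgroup P G" "card P = p ^ multiplicity p (order G)"
proof -
  have "order G = p ^ multiplicity p (order G) * (order G div p ^ multiplicity p (order G))"
    by (simp add: multiplicity_dvd)
  from sylow_thm[OF assms(2) is_group this assms(1)] that show thesis by blast
qed

text \<open>Comparing multiplicities prime by prime shows that the order of \<open>G\<close> divides
  \<open>card H\<close>. The normalizer of a Sylow subgroup will be treated this way.\<close>

lemma subgroup_eq_carrier_if_sylow:
  assumes fin: "finite (carrier G)" and H: "subgroup H G"
    and dvd: "\<And>p. Factorial_Ring.prime p \<Longrightarrow> p ^ multiplicity p (order G) dvd card H"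
  shows "H = carrier G"
proof -
  have "order G dvd card H"
  proof (rule multiplicity_le_imp_dvd)
    show "order G \<noteq> 0" using fin order_gt_0_iff_finite by simp
    fix p :: nat assume p: "Factorial_Ring.prime p"
    have "card H \<noteq> 0"
      using H fin by (metis card_0_eq empty_iff finite_subset subgroup.one_closed subgroup.subset)
    with dvd[OF p] p show "multiplicity p (order G) \<le> multiplicity p (card H)"
      by (intro multiplicity_geI) auto
  qed
  moreover have "card H > 0"
      using H fin by (metis card_gt_0_iff empty_iff finite_subset subgroup.one_closed subgroup.subset)
  ultimately have "order G \<le> card H" by (rule dvd_imp_le)
  then show ?thesis
    using H fin by (simp add: card_seteq order_def subgroup.subset)
qed

lemma nilpotent_sylow_normal:
  assumes nil: "nilpotent_group G" and fin: "finite (carrier G)" and p: "Factorial_Ring.prime p"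
    and P: "subgroup P G" and card: "card P = p ^ multiplicity p (order G)"
  shows "P \<lhd> G"
proof -
  \<comment> \<open>The normalizer of P contains a Sylow subgroup for every prime, since the Sylow
    q-subgroups with q different from p centralize P.\<close>
  define M where "M = {g \<in> carrier G. \<forall>x\<in>P. g \<otimes> x \<otimes> inv g \<in> P}"
  have Pc: "x \<in> carrier G" if "x \<in> P" for x using that P by (simp add: subgroup.mem_carrier)
  have M: "subgroup M G"
  proof (rule subgroupI)
    show "M \<subseteq> carrier G" by (auto simp: M_def)
    show "M \<noteq> {}" using Pc by (auto simp: M_def intro!: exI[of _ \<one>])
    show "g \<otimes> h \<in> M" if "g \<in> M" "h \<in> M" for g h
    proof -
      have "g \<otimes> h \<otimes> x \<otimes> inv (g \<otimes> h) = g \<otimes> (h \<otimes> x \<otimes> inv h) \<otimes> inv g" if "x \<in> P" for x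
        using \<open>g \<in> M\<close> \<open>h \<in> M\<close> Pc[OF that] by (simp add: M_def inv_mult_group m_assoc)
      then show ?thesis using that by (auto simp: M_def)
    qed
    \<comment> \<open>\<open>M\<close> asks only that conjugation by \<open>g\<close> maps
      \<open>P\<close> into itself. As \<open>P\<close> is finite, this injective map is onto, so
      conjugation by the inverse preserves \<open>P\<close> as well.\<close>
    show "inv g \<in> M" if g: "g \<in> M" for g
    proof -
      let ?f = "\<lambda>x. g \<otimes> x \<otimes> inv g"
      have gc: "g \<in> carrier G" using g by (simp add: M_def)
      have "inj_on ?f P" using gc Pc by (auto intro!: inj_onI)
      moreover have "?f ` P \<subseteq> P" using g by (auto simp: M_def)
      moreover have "finite P" using P fin by (meson finite_subset subgroup.subset)
      ultimately have surj: "?f ` P = P" by (metis endo_inj_surj)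
      have "inv g \<otimes> x \<otimes> inv (inv g) \<in> P" if x: "x \<in> P" for x
      proof -
        obtain y where y: "y \<in> P" "x = ?f y" using surj x by blast
        have yc: "y \<in> carrier G" using y Pc by simp
        then have "inv g \<otimes> (g \<otimes> y) = y" using gc by (simp add: m_assoc[symmetric])
        then have "inv g \<otimes> x \<otimes> inv (inv g) = y"
          using gc yc y by (simp add: m_assoc)
        then show ?thesis using y by simp
      qed
      then show ?thesis using gc by (auto simp: M_def)
    qed
  qed
  have "M = carrier G"
  proof (rule subgroup_eq_carrier_if_sylow[OF fin M])
    fix q :: nat assume q: "Factorial_Ring.prime q"
    show "q ^ multiplicity q (order G) dvd card M"
    proof (cases "q = p")
      case True
      have "P \<subseteq> M" using P by (auto simp: M_def subgroup.mem_carrier subgroup.m_closed subgroup.m_inv_closed)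
      then show ?thesis using card_subgroup_dvd[OF P M] card True by simp
    next
      case False
      obtain Q where Q: "subgroup Q G" "card Q = q ^ multiplicity q (order G)"
        using sylow_exists[OF fin q] .
      have "g \<otimes> x \<otimes> inv g = x" if "g \<in> Q" "x \<in> P" for g x
      proof -
        have "g \<otimes> x = x \<otimes> g"
          using nilpotent_p_elements_commute[OF nil _ _ q p False] that
            p_subgroup_subset_p_elements[OF Q q] p_subgroup_subset_p_elements[OF P card p] by blast
        then show ?thesis using that Pc Q by (simp add: m_assoc subgroup.mem_carrier)
      qed
      then have "Q \<subseteq> M" using Q by (auto simp: M_def subgroup.mem_carrier)
      then show ?thesis using card_subgroup_dvd[OF Q(1) M] Q by simp
    qed
  qed
  then show ?thesis
    using P by (auto simp: normal_inv_iff M_def)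
qed

text \<open>\<open>P\<close> is normal and its index is prime to \<open>p\<close>. For a p-element
  \<open>x\<close>, both the power by the index and some power by a p-power lie in \<open>P\<close>,
  hence so does \<open>x\<close>.\<close>

lemma nilpotent_sylow_eq_p_elements:
  assumes nil: "nilpotent_group G" and fin: "finite (carrier G)" and p: "Factorial_Ring.prime p"
    and P: "subgroup P G" and card: "card P = p ^ multiplicity p (order G)"
  shows "P = p_elements G p"
proof
  show "P \<subseteq> p_elements G p" using p_subgroup_subset_p_elements[OF P card p] .
  interpret P: normal P G using nilpotent_sylow_normal[OF assms] .
  interpret Q: group "G Mod P" by (rule P.factorgroup_is_group)
  let ?m = "order (G Mod P)"
  have m: "?m * card P = order G"
    using lagrange[OF P] by (simp add: order_def FactGroup_def)
  have ord0: "order G \<noteq> 0" using fin order_gt_0_iff_finite by simp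
  have cop: "coprime p ?m"
  proof (rule ccontr)
    assume "\<not> coprime p ?m"
    then have "p dvd ?m" using p prime_imp_coprime by blast
    then have "p * card P dvd order G" using m by (metis dvd_refl mult_dvd_mono)
    then have "p ^ Suc (multiplicity p (order G)) dvd order G" using card by simp
    then show False
      using p ord0 power_dvd_iff_le_multiplicity[of "order G" p] by (metis Suc_n_not_le_n not_prime_unit)
  qed
  show "p_elements G p \<subseteq> P"
  proof
    fix x assume "x \<in> p_elements G p"
    then obtain k where k: "x \<in> carrier G" "x [^] (p ^ k) = \<one>" by (auto simp: p_elements_def)
    have pw: "(P #> x) [^]\<^bsub>G Mod P\<^esub> n = P #> (x [^] n)" for n :: nat
      using k by (induction n) (auto simp: FactGroup_def P.rcos_sum coset_join2 P subgroup.subset P.is_subgroup)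
    have "P #> x \<in> carrier (G Mod P)" using k by (auto simp: FactGroup_def RCOSETS_def)
    from Q.pow_order_eq_1[OF this] have "P #> (x [^] ?m) = P" by (simp add: pw)
    then have "x [^] ?m \<in> P" using k P by (metis coset_join1 nat_pow_closed)
    moreover have "x [^] (p ^ k) \<in> P" using k P by (simp add: subgroup.one_closed)
    ultimately show "x \<in> P"
      using pow_coprime_mem[OF P k(1)] cop by (metis coprime_power_left_iff)
  qed
qed

lemma nilpotent_p_elements_sylow:
  assumes nil: "nilpotent_group G" and fin: "finite (carrier G)" and p: "Factorial_Ring.prime p"
  shows "subgroup (p_elements G p) G"
    and "card (p_elements G p) = p ^ multiplicity p (order G)"
  using sylow_exists[OF fin p] nilpotent_sylow_eq_p_elements[OF assms] by metis+

end

section \<open>Actions by automorphisms\<close>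

text \<open>Downward induction along \<open>S\<close>, which abstracts the left series, starting at
  its trivial term. The displacement \<open>b\<close> of \<open>x\<close> lies one term further and
  is again a p-element, because the p-elements form an \<open>f\<close>-invariant subgroup. So
  \<open>f\<close> fixes \<open>b\<close>, its iterates multiply \<open>x\<close> by powers of
  \<open>b\<close>, and the period \<open>q ^ m\<close> makes the order of \<open>b\<close> divide
  powers of two distinct primes.\<close>

lemma (in group) fixed_by_coprime_automorphism:
  assumes nil: "nilpotent_group G" and fin: "finite (carrier G)"
    and p: "Factorial_Ring.prime p" and q: "Factorial_Ring.prime q" "p \<noteq> q"
    and f: "f \<in> hom G G"
    and S0: "S 0 = carrier G" and Sn: "S n = {\<one>}"
    and S: "\<And>i x. x \<in> S i \<Longrightarrow> x \<in> carrier G \<Longrightarrow> f x \<otimes> inv x \<in> S (Suc i)"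
    and per: "\<And>x. x \<in> carrier G \<Longrightarrow> (f ^^ (q ^ m)) x = x"
    and a: "a \<in> p_elements G p"
  shows "f a = a"
proof -
  interpret f: group_hom G G f using f by unfold_locales
  have fA: "f x \<in> p_elements G p" if x: "x \<in> p_elements G p" for x
  proof -
    obtain k where k: "x \<in> carrier G" "x [^] (p ^ k) = \<one>" using x by (auto simp: p_elements_def)
    then have "f x [^] (p ^ k) = \<one>" using f.hom_nat_pow[of x "p ^ k"] by simp
    then show ?thesis using k by (auto simp: p_elements_def)
  qed
  interpret A: subgroup "p_elements G p" G
    using nilpotent_p_elements_sylow(1)[OF nil fin p] .
  have "\<forall>x \<in> S i \<inter> p_elements G p. f x = x" if "i \<le> n" for i
    using that
  proof (induction i rule: inc_induct)
    case base
    show ?case using Sn by simp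
  next
    case (step i)
    show ?case
    proof
      fix x assume x: "x \<in> S i \<inter> p_elements G p"
      define b where "b = f x \<otimes> inv x"
      have xc: "x \<in> carrier G" using x by simp
      then have bc: "b \<in> carrier G" by (simp add: b_def)
      have bA: "b \<in> p_elements G p" using x fA by (simp add: b_def)
      then have fb: "f b = b" using step.IH S x by (auto simp: b_def)
      have fx: "f x = b \<otimes> x" using xc by (simp add: b_def m_assoc)
      have "(f ^^ k) x = b [^] k \<otimes> x" for k
      proof (induction k)
        case 0
        show ?case using xc by simp
      next
        case (Suc k)
        then show ?case using fb fx xc bc by (simp add: f.hom_nat_pow m_assoc)
      qed
      from this[of "q ^ m"] have "b [^] (q ^ m) \<otimes> x = x" using per[OF xc] by simp
      then have "b [^] (q ^ m) = \<one>" using xc bc by simp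
      then have "b = \<one>"
        using p_element_coprime_pow_eq_one[OF bA] primes_coprime[OF p q] by simp
      then show "f x = x" using fx xc by simp
    qed
  qed
  from this[of 0] show ?thesis using a S0 by (simp add: p_elements_closed)
qed

section \<open>Actions on a finite group and their orbit sizes\<close>

lemma group_actionI:
  fixes K (structure)
  assumes K: "group K"
    and closed: "\<And>g x. g \<in> carrier K \<Longrightarrow> x \<in> E \<Longrightarrow> act g x \<in> E"
    and one: "\<And>x. x \<in> E \<Longrightarrow> act \<one> x = x"
    and mult: "\<And>g h x. g \<in> carrier K \<Longrightarrow> h \<in> carrier K \<Longrightarrow> x \<in> E \<Longrightarrow>
      act (g \<otimes> h) x = act g (act h x)"
  shows "group_action K E (\<lambda>g. restrict (act g) E)"
proof -
  interpret K: group K by fact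
  \<comment> \<open>\<open>Bij E\<close> consists of extensional functions, hence the restriction.
    The inverse group element supplies the inverse map.\<close>
  have bij: "restrict (act g) E \<in> Bij E" if g: "g \<in> carrier K" for g
  proof -
    have "act g (act (inv g) x) = x" "act (inv g) (act g x) = x" if "x \<in> E" for x
      using g that by (simp_all add: mult[symmetric] one)
    then have "bij_betw (act g) E E"
      by (intro bij_betw_byWitness[where f' = "act (inv g)"]) (use g closed in auto)
    then show ?thesis by (simp add: Bij_def)
  qed
  show ?thesis
    unfolding group_action_def group_hom_def group_hom_axioms_def
  proof (intro conjI homI)
    show "group (BijGroup E)" by (rule group_BijGroup)
    fix g h assume "g \<in> carrier K" "h \<in> carrier K"
    then show "restrict (act (g \<otimes> h)) E =
        restrict (act g) E \<otimes>\<^bsub>BijGroup E\<^esub> restrict (act h) E"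
      using bij by (auto simp: BijGroup_def compose_def mult closed fun_eq_iff)
  qed (use K bij in \<open>auto simp: BijGroup_def\<close>)
qed

text \<open>A common setting for both actions of a skew brace: \<open>K\<close> will be the circle
  group for lambda and the semidirect product for theta.\<close>

locale automorphism_action = N: group N + group_action K "carrier N" \<phi>
  for N :: "('a, 'b) monoid_scheme" and K :: "('c, 'd) monoid_scheme" and \<phi> +
  assumes act_mult: "\<And>g x y. g \<in> carrier K \<Longrightarrow> x \<in> carrier N \<Longrightarrow> y \<in> carrier N \<Longrightarrow>
      \<phi> g (x \<otimes>\<^bsub>N\<^esub> y) = \<phi> g x \<otimes>\<^bsub>N\<^esub> \<phi> g y"
    and finite_N: "finite (carrier N)" and finite_K: "finite (carrier K)"
begin

sublocale K: group K
  using group_hom by (simp add: group_hom_def)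

lemma act_closed [simp]: "g \<in> carrier K \<Longrightarrow> x \<in> carrier N \<Longrightarrow> \<phi> g x \<in> carrier N"
  using element_image by blast

lemma act_hom: "g \<in> carrier K \<Longrightarrow> \<phi> g \<in> hom N N"
  by (rule homI) (auto simp: act_mult)

lemma act_one [simp]: "x \<in> carrier N \<Longrightarrow> \<phi> \<one>\<^bsub>K\<^esub> x = x"
  using id_eq_one by (metis restrict_apply')

lemma act_N_one [simp]: "g \<in> carrier K \<Longrightarrow> \<phi> g \<one>\<^bsub>N\<^esub> = \<one>\<^bsub>N\<^esub>"
  using hom_one[OF act_hom N.is_group N.is_group] .

lemma act_inv: "g \<in> carrier K \<Longrightarrow> x \<in> carrier N \<Longrightarrow> \<phi> g (inv\<^bsub>N\<^esub> x) = inv\<^bsub>N\<^esub> (\<phi> g x)"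
  using act_mult[of g "inv\<^bsub>N\<^esub> x" x] by (intro N.inv_equality[symmetric]) simp_all

lemma act_pow: "g \<in> carrier K \<Longrightarrow> x \<in> carrier N \<Longrightarrow>
    \<phi> g (x [^]\<^bsub>N\<^esub> (k::nat)) = \<phi> g x [^]\<^bsub>N\<^esub> k"
  using hom_nat_pow[OF act_hom _ N.is_group N.is_group] by blast

lemma act_p_elements:
  assumes "g \<in> carrier K" "x \<in> p_elements N p"
  shows "\<phi> g x \<in> p_elements N p"
proof -
  obtain k where k: "x \<in> carrier N" "x [^]\<^bsub>N\<^esub> (p ^ k) = \<one>\<^bsub>N\<^esub>"
    using assms(2) by (auto simp: p_elements_def)
  then have "\<phi> g x [^]\<^bsub>N\<^esub> (p ^ k) = \<one>\<^bsub>N\<^esub>" using act_pow[of g x "p ^ k"] assms(1) by simp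
  then show ?thesis using k assms(1) by (auto simp: p_elements_def)
qed

lemma act_funpow:
  "g \<in> carrier K \<Longrightarrow> x \<in> carrier N \<Longrightarrow> \<phi> (g [^]\<^bsub>K\<^esub> (k::nat)) x = (\<phi> g ^^ k) x"
proof (induction k arbitrary: x)
  case (Suc k)
  then show ?case
    by (simp add: composition_rule funpow_swap1)
qed simp

lemma fixed_points_subgroup:
  assumes "g \<in> carrier K" shows "subgroup {x \<in> carrier N. \<phi> g x = x} N"
proof (rule N.subgroupI)
  show "{x \<in> carrier N. \<phi> g x = x} \<noteq> {}"
    using assms by (auto intro!: exI[of _ "\<one>\<^bsub>N\<^esub>"])
qed (use assms in \<open>auto simp: act_inv act_mult\<close>)

text \<open>Let \<open>j\<close> be the least positive exponent for which \<open>g\<close> fixes the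
  power of \<open>x\<close>. If a prime \<open>p\<close> divided \<open>j\<close>, let
  \<open>m\<close> be the part of the order of \<open>N\<close> prime to \<open>p\<close>. Then
  \<open>x [^] m\<close> is a p-element, hence fixed, so \<open>g\<close> fixes the power with
  exponent \<open>gcd j m\<close>; minimality makes \<open>j\<close> divide \<open>m\<close>, which
  is impossible. Contraposed, a moved element has a moved power that is a p-element.\<close>

lemma fixed_p_component:
  assumes g: "g \<in> carrier K" and x: "x \<in> carrier N"
    and p: "\<And>p k. Factorial_Ring.prime p \<Longrightarrow> x [^]\<^bsub>N\<^esub> (k::nat) \<in> p_elements N p \<Longrightarrow>
      \<phi> g (x [^]\<^bsub>N\<^esub> k) = x [^]\<^bsub>N\<^esub> k"
  shows "\<phi> g x = x"
proof -
  let ?F = "{x \<in> carrier N. \<phi> g x = x}"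
  note F = fixed_points_subgroup[OF g]
  define j where "j = (LEAST j::nat. j > 0 \<and> x [^]\<^bsub>N\<^esub> j \<in> ?F)"
  have ord: "order N > 0" using finite_N N.order_gt_0_iff_finite by simp
  have "x [^]\<^bsub>N\<^esub> order N \<in> ?F" using g x finite_N N.pow_order_eq_1 by simp
  with ord have ex: "\<exists>j::nat. j > 0 \<and> x [^]\<^bsub>N\<^esub> j \<in> ?F"
    by (intro exI[of _ "order N"] conjI)
  have j: "j > 0" "x [^]\<^bsub>N\<^esub> j \<in> ?F" using LeastI_ex[OF ex] by (auto simp: j_def)
  have "j = 1"
  proof (rule ccontr)
    assume "j \<noteq> 1"
    then obtain p where pr: "Factorial_Ring.prime p" and pj: "p dvd j" using prime_factor_nat by blast
    obtain m where m: "order N = p ^ multiplicity p (order N) * m" "\<not> p dvd m"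
      using ord pr multiplicity_decompose'[of "order N" p] by (metis not_gr0 not_prime_unit)
    have "(x [^]\<^bsub>N\<^esub> m) [^]\<^bsub>N\<^esub> (p ^ multiplicity p (order N)) = x [^]\<^bsub>N\<^esub> order N"
      using x m(1) by (metis N.nat_pow_pow mult.commute)
    then have "x [^]\<^bsub>N\<^esub> m \<in> p_elements N p"
      using x finite_N N.pow_order_eq_1 by (auto simp: p_elements_def)
    then have "x [^]\<^bsub>N\<^esub> m \<in> ?F" using p[OF pr] x by simp
    then have "x [^]\<^bsub>N\<^esub> gcd j m \<in> ?F" using N.pow_gcd_mem[OF F x j(2)] by blast
    then have "j \<le> gcd j m" using j unfolding j_def by (intro Least_le) auto
    then have "j dvd m" using j(1) by (metis dvd_imp_le gcd_dvd1 gcd_dvd2 le_antisym)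
    then show False using pj m(2) dvd_trans by blast
  qed
  then show ?thesis using j(2) x by simp
qed

lemma finite_orbit: "finite (orbit K \<phi> x)"
  using finite_K by (simp add: orbit_def Setcompr_eq_image)

text \<open>Orbit sizes are indices of stabilizers, so enlarging the stabilizer divides the
  index.\<close>

lemma card_orbit_dvd_if_stabilizer_subset:
  assumes "x \<in> carrier N" "y \<in> carrier N" "stabilizer K \<phi> x \<subseteq> stabilizer K \<phi> y"
  shows "card (orbit K \<phi> y) dvd card (orbit K \<phi> x)"
proof -
  obtain t where t: "card (stabilizer K \<phi> y) = card (stabilizer K \<phi> x) * t"
    using K.card_subgroup_dvd stabilizer_subgroup assms by (meson dvdE)
  have eq: "card (orbit K \<phi> x) * card (stabilizer K \<phi> x) = card (orbit K \<phi> y) * card (stabilizer K \<phi> y)"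
    using orbit_stabilizer_theorem assms by simp
  have "card (orbit K \<phi> x) * card (stabilizer K \<phi> x) \<noteq> 0"
    using orbit_stabilizer_theorem[OF assms(1)] finite_K K.order_gt_0_iff_finite by simp
  then have "card (stabilizer K \<phi> x) \<noteq> 0" by simp
  moreover have "card (orbit K \<phi> x) * card (stabilizer K \<phi> x) =
      card (orbit K \<phi> y) * t * card (stabilizer K \<phi> x)"
    using eq t by (simp add: ac_simps)
  ultimately have "card (orbit K \<phi> x) = card (orbit K \<phi> y) * t" by simp
  then show ?thesis by simp
qed

lemma card_orbit_gt_1_iff:
  assumes "x \<in> carrier N"
  shows "card (orbit K \<phi> x) > 1 \<longleftrightarrow> (\<exists>g\<in>carrier K. \<phi> g x \<noteq> x)"
proof
  assume card: "card (orbit K \<phi> x) > 1"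
  show "\<exists>g\<in>carrier K. \<phi> g x \<noteq> x"
  proof (rule ccontr)
    assume "\<not> ?thesis"
    then have "orbit K \<phi> x \<subseteq> {x}" by (auto simp: orbit_def)
    then have "card (orbit K \<phi> x) \<le> card {x}" by (intro card_mono) simp_all
    then show False using card by simp
  qed
next
  assume "\<exists>g\<in>carrier K. \<phi> g x \<noteq> x"
  then obtain g where g: "g \<in> carrier K" "\<phi> g x \<noteq> x" by blast
  then have "{x, \<phi> g x} \<subseteq> orbit K \<phi> x"
    using orbit_refl[OF assms] by (auto simp: orbit_def)
  from card_mono[OF finite_orbit this] g show "card (orbit K \<phi> x) > 1" by simp
qed

text \<open>The stabilizer contains \<open>Q\<close> and so absorbs the full q-part of the order of
  \<open>K\<close>. A further factor \<open>q\<close> in the orbit size would contradict the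
  orbit-stabilizer theorem.\<close>

lemma not_dvd_card_orbit:
  assumes x: "x \<in> carrier N" and q: "Factorial_Ring.prime q"
    and Q: "subgroup Q K" "q ^ multiplicity q (order K) dvd card Q"
    and fixed: "\<And>g. g \<in> Q \<Longrightarrow> \<phi> g x = x"
  shows "\<not> q dvd card (orbit K \<phi> x)"
proof
  assume "q dvd card (orbit K \<phi> x)"
  moreover have "Q \<subseteq> stabilizer K \<phi> x"
    using fixed Q by (auto simp: stabilizer_def subgroup.mem_carrier)
  then have "q ^ multiplicity q (order K) dvd card (stabilizer K \<phi> x)"
    using K.card_subgroup_dvd[OF Q(1) stabilizer_subgroup[OF x]] Q(2) dvd_trans by blast
  ultimately have "q * q ^ multiplicity q (order K) dvd order K"
    using orbit_stabilizer_theorem[OF x] by (metis mult_dvd_mono)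
  moreover have "order K \<noteq> 0" using finite_K K.order_gt_0_iff_finite by simp
  moreover have "\<not> is_unit q" using q not_prime_unit by blast
  ultimately show False
    using power_dvd_iff_le_multiplicity[of "order K" q "Suc (multiplicity q (order K))"] by simp
qed

end

section \<open>The orbit graph\<close>

lemma graph_connected_if_diameter_le_2:
  assumes "diameter_le_2 V E" shows "graph_connected V E"
  unfolding graph_connected_def
proof (intro ballI)
  fix x y assume xy: "x \<in> V" "y \<in> V"
  let ?R = "\<lambda>u v. u \<in> V \<and> v \<in> V \<and> E u v"
  consider "x = y" | "E x y" | z where "z \<in> V" "E x z" "E z y"
    using assms xy unfolding diameter_le_2_def by blast
  then show "?R\<^sup>*\<^sup>* x y"
  proof cases
    case 3
    then have "?R\<^sup>*\<^sup>* x z" "?R\<^sup>*\<^sup>* z y" using xy by auto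
    then show ?thesis by (rule rtranclp_trans)
  qed (use xy in auto)
qed

text \<open>This isolates what the graph argument takes from left nilpotency: orbits of p-elements
  have p-power size, expressed by excluding every other prime.\<close>

locale nilpotent_primary_action = automorphism_action +
  assumes nilpotent: "nilpotent_group N"
    and primary: "\<And>p q a. Factorial_Ring.prime p \<Longrightarrow> Factorial_Ring.prime q \<Longrightarrow> p \<noteq> q \<Longrightarrow>
      a \<in> p_elements N p \<Longrightarrow> \<not> q dvd card (orbit K \<phi> a)"
begin

lemma nontrivial_orbit_p_element:
  assumes x: "x \<in> carrier N" and card: "card (orbit K \<phi> x) > 1"
  obtains p a where "Factorial_Ring.prime p" "a \<in> p_elements N p"
    "p dvd card (orbit K \<phi> a)" "p dvd card (orbit K \<phi> x)"
proof -
  obtain g where g: "g \<in> carrier K" "\<phi> g x \<noteq> x" using card card_orbit_gt_1_iff[OF x] by blast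
  then obtain p and k :: nat where p: "Factorial_Ring.prime p" and a: "x [^]\<^bsub>N\<^esub> k \<in> p_elements N p"
    and moved: "\<phi> g (x [^]\<^bsub>N\<^esub> k) \<noteq> x [^]\<^bsub>N\<^esub> k"
    using fixed_p_component[OF g(1) x] by blast
  have "card (orbit K \<phi> (x [^]\<^bsub>N\<^esub> k)) > 1"
    using moved g x card_orbit_gt_1_iff by auto
  then obtain q where q: "Factorial_Ring.prime q" "q dvd card (orbit K \<phi> (x [^]\<^bsub>N\<^esub> k))"
    using prime_factor_nat by (metis less_irrefl)
  \<comment> \<open>Some prime divides the orbit size of the moved power, and \<open>primary\<close>
    forces it to be \<open>p\<close>.\<close>
  then have pd: "p dvd card (orbit K \<phi> (x [^]\<^bsub>N\<^esub> k))" using primary[OF p q(1) _ a] by blast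
  have "stabilizer K \<phi> x \<subseteq> stabilizer K \<phi> (x [^]\<^bsub>N\<^esub> k)"
    using x by (auto simp: stabilizer_def act_pow)
  then have "p dvd card (orbit K \<phi> x)"
    using card_orbit_dvd_if_stabilizer_subset[of x "x [^]\<^bsub>N\<^esub> k"] x pd dvd_trans by auto
  with p a pd that show thesis by blast
qed

text \<open>As \<open>a\<close> and \<open>b\<close> commute, raising their product to the order
  \<open>q ^ j\<close> kills \<open>b\<close> and leaves a power of \<open>a\<close> with exponent
  prime to \<open>p\<close>. Whatever fixes the product therefore fixes \<open>a\<close>, and the
  stabilizers are nested.\<close>

lemma card_orbit_dvd_mult:
  assumes pq: "Factorial_Ring.prime p" "Factorial_Ring.prime q" "p \<noteq> q"
    and a: "a \<in> p_elements N p" and b: "b \<in> p_elements N q"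
  shows "card (orbit K \<phi> a) dvd card (orbit K \<phi> (a \<otimes>\<^bsub>N\<^esub> b))"
proof (rule card_orbit_dvd_if_stabilizer_subset)
  obtain i j where ij: "a [^]\<^bsub>N\<^esub> (p ^ i) = \<one>\<^bsub>N\<^esub>" "b [^]\<^bsub>N\<^esub> (q ^ j) = \<one>\<^bsub>N\<^esub>"
    and c: "a \<in> carrier N" "b \<in> carrier N"
    using a b by (auto simp: p_elements_def)
  show "a \<otimes>\<^bsub>N\<^esub> b \<in> carrier N" "a \<in> carrier N" using c by auto
  have "a \<otimes>\<^bsub>N\<^esub> b = b \<otimes>\<^bsub>N\<^esub> a"
    using N.nilpotent_p_elements_commute[OF nilpotent a b pq] .
  then have pow: "(a \<otimes>\<^bsub>N\<^esub> b) [^]\<^bsub>N\<^esub> (q ^ j) = a [^]\<^bsub>N\<^esub> (q ^ j)"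
    using c ij by (simp add: N.pow_mult_distrib)
  show "stabilizer K \<phi> (a \<otimes>\<^bsub>N\<^esub> b) \<subseteq> stabilizer K \<phi> a"
  proof
    fix g assume "g \<in> stabilizer K \<phi> (a \<otimes>\<^bsub>N\<^esub> b)"
    then have g: "g \<in> carrier K" and ab: "\<phi> g (a \<otimes>\<^bsub>N\<^esub> b) = a \<otimes>\<^bsub>N\<^esub> b"
      by (auto simp: stabilizer_def)
    let ?F = "{x \<in> carrier N. \<phi> g x = x}"
    have "a [^]\<^bsub>N\<^esub> (q ^ j) \<in> ?F"
      using act_pow[OF g, of "a \<otimes>\<^bsub>N\<^esub> b" "q ^ j"] c ab by (simp add: pow)
    moreover have "a [^]\<^bsub>N\<^esub> (p ^ i) \<in> ?F" using ij g by simp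
    ultimately have "a \<in> ?F"
      using N.pow_coprime_mem[OF fixed_points_subgroup[OF g] c(1), of "q ^ j" "p ^ i"]
        primes_coprime[OF pq(2,1)] pq(3) by simp
    then show "g \<in> stabilizer K \<phi> a" using g by (simp add: stabilizer_def)
  qed
qed

theorem orbit_graph_diameter_le_2:
  "diameter_le_2 (orbit_vertices (carrier N) (orbit K \<phi>)) orbit_adj"
  unfolding diameter_le_2_def
proof (intro ballI impI)
  let ?V = "orbit_vertices (carrier N) (orbit K \<phi>)"
  fix L M :: "'a set" assume LM: "L \<in> ?V" "M \<in> ?V" and ne: "L \<noteq> M"
  then obtain x y where x: "x \<in> carrier N" "L = orbit K \<phi> x" "card L > 1"
    and y: "y \<in> carrier N" "M = orbit K \<phi> y" "card M > 1"
    unfolding orbit_vertices_def by blast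
  show "orbit_adj L M \<or> (\<exists>Z\<in>?V. orbit_adj L Z \<and> orbit_adj Z M)"
  proof (cases "gcd (card L) (card M) = 1")
    case False
    then show ?thesis using ne by (simp add: orbit_adj_def)
  next
    case cop: True
    obtain p a where p: "Factorial_Ring.prime p" "a \<in> p_elements N p"
      "p dvd card (orbit K \<phi> a)" "p dvd card L"
      unfolding x(2) using nontrivial_orbit_p_element[OF x(1) x(3)[unfolded x(2)]] .
    obtain q b where q: "Factorial_Ring.prime q" "b \<in> p_elements N q"
      "q dvd card (orbit K \<phi> b)" "q dvd card M"
      unfolding y(2) using nontrivial_orbit_p_element[OF y(1) y(3)[unfolded y(2)]] .
    have common: "gcd m n \<noteq> 1" if "Factorial_Ring.prime r" "r dvd m" "r dvd n" for r m n :: nat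
    proof
      assume "gcd m n = 1"
      then have "is_unit r" using gcd_greatest[OF that(2,3)] by simp
      then show False using that(1) not_prime_unit by blast
    qed
    have pq: "p \<noteq> q"
    proof
      assume "p = q"
      then show False using common[OF p(1,4)] q(4) cop by simp
    qed
    let ?Z = "orbit K \<phi> (a \<otimes>\<^bsub>N\<^esub> b)"
    have c: "a \<otimes>\<^bsub>N\<^esub> b \<in> carrier N" using p q by (simp add: N.p_elements_closed)
    \<comment> \<open>Commutation allows \<open>card_orbit_dvd_mult\<close> to be applied to
      \<open>b\<close> as well.\<close>
    have comm: "a \<otimes>\<^bsub>N\<^esub> b = b \<otimes>\<^bsub>N\<^esub> a"
      using N.nilpotent_p_elements_commute[OF nilpotent p(2) q(2) p(1) q(1) pq] .
    have pZ: "p dvd card ?Z"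
      using card_orbit_dvd_mult[OF p(1) q(1) pq p(2) q(2)] p(3) dvd_trans by blast
    have qZ: "q dvd card ?Z"
      using dvd_trans[OF q(3) card_orbit_dvd_mult[OF q(1) p(1) pq[symmetric] q(2) p(2)]]
      by (subst comm)
    have "card ?Z \<noteq> 0" using finite_orbit orbit_refl[OF c] by (metis card_0_eq empty_iff)
    moreover have "card ?Z \<noteq> 1"
    proof
      assume "card ?Z = 1"
      then show False using pZ p(1) not_prime_unit by simp
    qed
    ultimately have "card ?Z > 1" by linarith
    then have Z: "?Z \<in> ?V" using c unfolding orbit_vertices_def by blast
    \<comment> \<open>Adjacency requires distinct vertices. If \<open>?Z\<close> were
      \<open>L\<close>, then \<open>q\<close> would divide the coprime numbers \<open>card L\<close>
      and \<open>card M\<close>; the case of \<open>M\<close> is symmetric with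
      \<open>p\<close>.\<close>
    have "?Z \<noteq> L" using common[OF q(1) _ q(4)] qZ cop by metis
    then have "orbit_adj L ?Z" using common[OF p(1,4) pZ] unfolding orbit_adj_def by simp
    have "?Z \<noteq> M" using common[OF p(1,4)] pZ cop by metis
    then have "orbit_adj ?Z M" using common[OF q(1) qZ q(4)] unfolding orbit_adj_def by simp
    then show ?thesis using Z \<open>orbit_adj L ?Z\<close> by blast
  qed
qed

end

section \<open>Semidirect products\<close>

definition semidirect ::
  "('a, 'b) monoid_scheme \<Rightarrow> ('c, 'd) monoid_scheme \<Rightarrow> ('c \<Rightarrow> 'a \<Rightarrow> 'a) \<Rightarrow> ('a \<times> 'c) monoid" where
  "semidirect N K \<phi> = \<lparr>carrier = carrier N \<times> carrier K,
     monoid.mult = (\<lambda>a b. (fst a \<otimes>\<^bsub>N\<^esub> \<phi> (snd a) (fst b), snd a \<otimes>\<^bsub>K\<^esub> snd b)),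
     one = (\<one>\<^bsub>N\<^esub>, \<one>\<^bsub>K\<^esub>)\<rparr>"

text \<open>The automorphism given by the second component, followed by conjugation by the first.
  For the additive group and lambda this is theta.\<close>

definition affine_act ::
  "('a, 'b) monoid_scheme \<Rightarrow> ('c \<Rightarrow> 'a \<Rightarrow> 'a) \<Rightarrow> 'a \<times> 'c \<Rightarrow> 'a \<Rightarrow> 'a" where
  "affine_act N \<phi> a x = fst a \<otimes>\<^bsub>N\<^esub> \<phi> (snd a) x \<otimes>\<^bsub>N\<^esub> inv\<^bsub>N\<^esub> (fst a)"

context automorphism_action
begin

lemma semidirect_group: "group (semidirect N K \<phi>)"
proof (rule groupI)
  fix a assume a: "a \<in> carrier (semidirect N K \<phi>)"
  obtain u g where ug: "a = (u, g)" "u \<in> carrier N" "g \<in> carrier K"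
    using a by (auto simp: semidirect_def)
  let ?h = "inv\<^bsub>K\<^esub> g"
  have "\<phi> ?h (inv\<^bsub>N\<^esub> u) \<otimes>\<^bsub>N\<^esub> \<phi> ?h u = \<one>\<^bsub>N\<^esub>"
    using ug by (simp add: act_mult[symmetric])
  then show "\<exists>b\<in>carrier (semidirect N K \<phi>). b \<otimes>\<^bsub>semidirect N K \<phi>\<^esub> a = \<one>\<^bsub>semidirect N K \<phi>\<^esub>"
    using ug by (intro bexI[of _ "(\<phi> ?h (inv\<^bsub>N\<^esub> u), ?h)"]) (simp_all add: semidirect_def)
qed (auto simp: semidirect_def act_mult composition_rule N.m_assoc K.m_assoc)

lemma semidirect_inv:
  assumes "u \<in> carrier N" "g \<in> carrier K"
  shows "inv\<^bsub>semidirect N K \<phi>\<^esub> (u, g) = (\<phi> (inv\<^bsub>K\<^esub> g) (inv\<^bsub>N\<^esub> u), inv\<^bsub>K\<^esub> g)"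
proof (rule group.inv_equality[OF semidirect_group])
  have "\<phi> (inv\<^bsub>K\<^esub> g) (inv\<^bsub>N\<^esub> u) \<otimes>\<^bsub>N\<^esub> \<phi> (inv\<^bsub>K\<^esub> g) u = \<one>\<^bsub>N\<^esub>"
    using assms by (simp add: act_mult[symmetric])
  then show "(\<phi> (inv\<^bsub>K\<^esub> g) (inv\<^bsub>N\<^esub> u), inv\<^bsub>K\<^esub> g) \<otimes>\<^bsub>semidirect N K \<phi>\<^esub> (u, g) = \<one>\<^bsub>semidirect N K \<phi>\<^esub>"
    using assms by (simp add: semidirect_def)
qed (use assms in \<open>simp_all add: semidirect_def\<close>)

lemma affine_action:
  "automorphism_action N (semidirect N K \<phi>) (\<lambda>a. restrict (affine_act N \<phi> a) (carrier N))"
  (is "automorphism_action N ?S ?\<psi>")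
proof -
  have "group_action ?S (carrier N) ?\<psi>"
  proof (rule group_actionI[OF semidirect_group])
    fix a b x assume "a \<in> carrier ?S" "b \<in> carrier ?S" "x \<in> carrier N"
    then show "affine_act N \<phi> (a \<otimes>\<^bsub>?S\<^esub> b) x = affine_act N \<phi> a (affine_act N \<phi> b x)"
      by (auto simp: affine_act_def semidirect_def act_mult act_inv composition_rule
          N.inv_mult_group N.m_assoc)
  qed (auto simp: affine_act_def semidirect_def)
  moreover have "finite (carrier ?S)" using finite_N finite_K by (simp add: semidirect_def)
  moreover have "?\<psi> a (x \<otimes>\<^bsub>N\<^esub> y) = ?\<psi> a x \<otimes>\<^bsub>N\<^esub> ?\<psi> a y"
    if a: "a \<in> carrier ?S" and xy: "x \<in> carrier N" "y \<in> carrier N" for a x y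
  proof -
    obtain u g where ug: "a = (u, g)" "u \<in> carrier N" "g \<in> carrier K"
      using a by (auto simp: semidirect_def)
    have "inv\<^bsub>N\<^esub> u \<otimes>\<^bsub>N\<^esub> (u \<otimes>\<^bsub>N\<^esub> z) = z" if "z \<in> carrier N" for z
      using that ug by (simp add: N.m_assoc[symmetric])
    then show ?thesis
      using ug xy by (simp add: affine_act_def act_mult N.m_assoc)
  qed
  ultimately show ?thesis
    using finite_N N.is_group
    unfolding automorphism_action_def automorphism_action_axioms_def by blast
qed

end

text \<open>\<open>S\<close> models the left series of a left nilpotent skew brace. With lambda as
  the action, the element in the last assumption is the star product of \<open>g\<close> and
  \<open>x\<close>.\<close>

locale stable_action = automorphism_action +
  fixes S :: "nat \<Rightarrow> 'a set" and n :: nat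
  assumes nilpotent_N: "nilpotent_group N"
    and S_0: "S 0 = carrier N" and S_n: "S n = {\<one>\<^bsub>N\<^esub>}"
    and S_Suc: "\<And>i g x. g \<in> carrier K \<Longrightarrow> x \<in> carrier N \<Longrightarrow> x \<in> S i \<Longrightarrow>
      \<phi> g x \<otimes>\<^bsub>N\<^esub> inv\<^bsub>N\<^esub> x \<in> S (Suc i)"
begin

lemma fixed_by_p_element:
  assumes p: "Factorial_Ring.prime p" and q: "Factorial_Ring.prime q" "p \<noteq> q"
    and a: "a \<in> p_elements N p" and g: "g \<in> p_elements K q"
  shows "\<phi> g a = a"
proof -
  obtain m where gK: "g \<in> carrier K" and m: "g [^]\<^bsub>K\<^esub> (q ^ m) = \<one>\<^bsub>K\<^esub>"
    using g by (auto simp: p_elements_def)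
  have "(\<phi> g ^^ (q ^ m)) x = x" if "x \<in> carrier N" for x
    using act_funpow[OF gK that, of "q ^ m"] m that by simp
  from N.fixed_by_coprime_automorphism[where S = S, OF nilpotent_N finite_N p q act_hom[OF gK] S_0 S_n _ this a]
  show ?thesis using S_Suc[OF gK] by blast
qed

lemma primary_action: "nilpotent_primary_action N K \<phi>"
proof
  show "nilpotent_group N" by (rule nilpotent_N)
  fix p q a assume pq: "Factorial_Ring.prime p" "Factorial_Ring.prime q" "p \<noteq> q"
    and a: "a \<in> p_elements N p"
  obtain Q where Q: "subgroup Q K" "card Q = q ^ multiplicity q (order K)"
    using K.sylow_exists[OF finite_K pq(2)] .
  show "\<not> q dvd card (orbit K \<phi> a)"
  proof (rule not_dvd_card_orbit[OF N.p_elements_closed[OF a] pq(2) Q(1)])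
    show "q ^ multiplicity q (order K) dvd card Q" using Q(2) by simp
    show "\<phi> g a = a" if "g \<in> Q" for g
      using fixed_by_p_element[OF pq a] K.p_subgroup_subset_p_elements[OF Q pq(2)] that by blast
  qed
qed

text \<open>The set \<open>?T\<close> is a Sylow q-subgroup of the semidirect product. It is closed
  because \<open>K\<close> preserves the q-elements of \<open>N\<close>, and its size is the full
  q-part because multiplicities add. It fixes \<open>a\<close>: the factor \<open>Q\<close> does so
  by the coprime argument, and the q-elements of \<open>N\<close> commute with
  \<open>a\<close>.\<close>

lemma affine_primary_action:
  "nilpotent_primary_action N (semidirect N K \<phi>) (\<lambda>a. restrict (affine_act N \<phi> a) (carrier N))"
  (is "nilpotent_primary_action N ?S ?\<psi>")
proof -
  interpret A: automorphism_action N ?S ?\<psi> by (rule affine_action)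
  show ?thesis
  proof
    show "nilpotent_group N" by (rule nilpotent_N)
    fix p q a assume pq: "Factorial_Ring.prime p" "Factorial_Ring.prime q" "p \<noteq> q"
      and a: "a \<in> p_elements N p"
    obtain Q where Q: "subgroup Q K" "card Q = q ^ multiplicity q (order K)"
      using K.sylow_exists[OF finite_K pq(2)] .
    note Nq = N.nilpotent_p_elements_sylow[OF nilpotent_N finite_N pq(2)]
    have ac: "a \<in> carrier N" using a by (rule N.p_elements_closed)
    let ?T = "p_elements N q \<times> Q"
    have TS: "?T \<subseteq> carrier ?S"
      using Q N.p_elements_closed by (auto simp: semidirect_def subgroup.mem_carrier)
    have T: "subgroup ?T ?S"
    proof (rule A.K.subgroupI[OF TS])
      show "?T \<noteq> {}"
        using subgroup.one_closed[OF Nq(1)] subgroup.one_closed[OF Q(1)] by blast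
      fix s assume "s \<in> ?T"
      then obtain u g where s: "s = (u, g)" "u \<in> p_elements N q" "g \<in> Q" by blast
      note uc = N.p_elements_closed[OF s(2)] and gc = subgroup.mem_carrier[OF Q(1) s(3)]
      have ig: "inv\<^bsub>K\<^esub> g \<in> Q" using subgroup.m_inv_closed[OF Q(1) s(3)] .
      have "\<phi> (inv\<^bsub>K\<^esub> g) (inv\<^bsub>N\<^esub> u) \<in> p_elements N q"
        using act_p_elements[OF K.inv_closed[OF gc] subgroup.m_inv_closed[OF Nq(1) s(2)]] .
      then show "inv\<^bsub>?S\<^esub> s \<in> ?T"
        unfolding s(1) semidirect_inv[OF uc gc] using ig by simp
      fix t assume "t \<in> ?T"
      then obtain v h where t: "t = (v, h)" "v \<in> p_elements N q" "h \<in> Q" by blast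
      show "s \<otimes>\<^bsub>?S\<^esub> t \<in> ?T"
        using subgroup.m_closed[OF Nq(1) s(2) act_p_elements[OF gc t(2)]]
          subgroup.m_closed[OF Q(1) s(3) t(3)]
        by (simp add: s(1) t(1) semidirect_def)
    qed
    have ord: "order N \<noteq> 0" "order K \<noteq> 0"
      using finite_N finite_K N.order_gt_0_iff_finite K.order_gt_0_iff_finite by simp_all
    have "order ?S = order N * order K" by (simp add: semidirect_def order_def card_cartesian_product)
    then have "multiplicity q (order ?S) = multiplicity q (order N) + multiplicity q (order K)"
      using prime_elem_multiplicity_mult_distrib[of q "order N" "order K"] pq(2) ord by simp
    then have card_T: "q ^ multiplicity q (order ?S) dvd card ?T"
      using Nq(2) Q(2) by (simp add: card_cartesian_product power_add)
    have "?\<psi> s a = a" if sT: "s \<in> ?T" for s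
    proof -
      obtain u g where s: "s = (u, g)" "u \<in> p_elements N q" "g \<in> Q" using sT by blast
      have "\<phi> g a = a"
        using fixed_by_p_element[OF pq a] K.p_subgroup_subset_p_elements[OF Q pq(2)] s(3) by blast
      moreover have "u \<otimes>\<^bsub>N\<^esub> a = a \<otimes>\<^bsub>N\<^esub> u"
        using N.nilpotent_p_elements_commute[OF nilpotent_N a s(2) pq] by (rule sym)
      ultimately show ?thesis
        using ac N.p_elements_closed[OF s(2)] by (simp add: s(1) affine_act_def N.m_assoc)
    qed
    then show "\<not> q dvd card (orbit ?S ?\<psi> a)"
      by (rule A.not_dvd_card_orbit[OF ac pq(2) T card_T])
  qed
qed

end

section \<open>Skew braces\<close>

locale finite_skew_brace =
  fixes P C :: "'a monoid"
  assumes skew_brace: "skew_brace P C" and finite_P: "finite (carrier P)"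
begin

sublocale P: group P using skew_brace by (simp add: skew_brace_def)
sublocale C: group C using skew_brace by (simp add: skew_brace_def)

lemma carrier_C [simp]: "carrier C = carrier P"
  and one_C [simp]: "\<one>\<^bsub>C\<^esub> = \<one>\<^bsub>P\<^esub>"
  using skew_brace by (simp_all add: skew_brace_def)

lemma circ_closed [simp]:
  "a \<in> carrier P \<Longrightarrow> b \<in> carrier P \<Longrightarrow> a \<otimes>\<^bsub>C\<^esub> b \<in> carrier P"
  using C.m_closed by simp

lemma circ_distrib:
  "a \<in> carrier P \<Longrightarrow> b \<in> carrier P \<Longrightarrow> c \<in> carrier P \<Longrightarrow>
    a \<otimes>\<^bsub>C\<^esub> (b \<otimes>\<^bsub>P\<^esub> c) = (a \<otimes>\<^bsub>C\<^esub> b) \<otimes>\<^bsub>P\<^esub> inv\<^bsub>P\<^esub> a \<otimes>\<^bsub>P\<^esub> (a \<otimes>\<^bsub>C\<^esub> c)"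
  using skew_brace by (simp add: skew_brace_def)

abbreviation lam :: "'a \<Rightarrow> 'a \<Rightarrow> 'a" where
  "lam \<equiv> sb_lambda P C"

lemma lambda_closed [simp]: "a \<in> carrier P \<Longrightarrow> b \<in> carrier P \<Longrightarrow> lam a b \<in> carrier P"
  by (simp add: sb_lambda_def)

lemma circ_eq: "a \<in> carrier P \<Longrightarrow> b \<in> carrier P \<Longrightarrow> a \<otimes>\<^bsub>C\<^esub> b = a \<otimes>\<^bsub>P\<^esub> lam a b"
  by (simp add: sb_lambda_def P.m_assoc[symmetric])

lemma lambda_mult:
  "a \<in> carrier P \<Longrightarrow> b \<in> carrier P \<Longrightarrow> c \<in> carrier P \<Longrightarrow>
    lam a (b \<otimes>\<^bsub>P\<^esub> c) = lam a b \<otimes>\<^bsub>P\<^esub> lam a c"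
  by (simp add: sb_lambda_def circ_distrib P.m_assoc)

text \<open>Associativity of the circle operation, rewritten through \<open>circ_eq\<close> on both
  sides, gives the claim after cancelling the circle product of \<open>a\<close> and
  \<open>b\<close> on the left.\<close>

lemma lambda_circ:
  assumes "a \<in> carrier P" "b \<in> carrier P" "c \<in> carrier P"
  shows "lam (a \<otimes>\<^bsub>C\<^esub> b) c = lam a (lam b c)"
proof -
  have "(a \<otimes>\<^bsub>C\<^esub> b) \<otimes>\<^bsub>P\<^esub> lam (a \<otimes>\<^bsub>C\<^esub> b) c = (a \<otimes>\<^bsub>C\<^esub> b) \<otimes>\<^bsub>C\<^esub> c"
    using assms by (simp add: circ_eq[of "a \<otimes>\<^bsub>C\<^esub> b"])
  also have "\<dots> = a \<otimes>\<^bsub>C\<^esub> (b \<otimes>\<^bsub>C\<^esub> c)"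
    using assms by (simp add: C.m_assoc)
  also have "\<dots> = a \<otimes>\<^bsub>P\<^esub> lam a (b \<otimes>\<^bsub>P\<^esub> lam b c)"
    using assms by (simp add: circ_eq[of b c] circ_eq[of a])
  also have "\<dots> = (a \<otimes>\<^bsub>P\<^esub> lam a b) \<otimes>\<^bsub>P\<^esub> lam a (lam b c)"
    using assms by (simp add: lambda_mult P.m_assoc)
  also have "a \<otimes>\<^bsub>P\<^esub> lam a b = a \<otimes>\<^bsub>C\<^esub> b"
    using assms by (simp add: circ_eq)
  finally show ?thesis using assms by simp
qed

lemma lambda_action: "automorphism_action P C (\<lambda>a. restrict (lam a) (carrier P))"
proof -
  have "group_action C (carrier P) (\<lambda>a. restrict (lam a) (carrier P))"
  proof (rule group_actionI[OF C.is_group])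
    show "lam \<one>\<^bsub>C\<^esub> x = x" if "x \<in> carrier P" for x
      using that C.l_one[of x] by (simp add: sb_lambda_def)
  qed (simp_all add: lambda_circ)
  then show ?thesis
    using P.is_group finite_P
    unfolding automorphism_action_def automorphism_action_axioms_def
    by (simp add: lambda_mult)
qed

lemma lambda_stable_action:
  assumes "left_series P C n = {\<one>\<^bsub>P\<^esub>}" "nilpotent_group P"
  shows "stable_action P C (\<lambda>a. restrict (lam a) (carrier P)) (left_series P C) n"
proof -
  \<comment> \<open>The star product is the displacement of \<open>x\<close> under
    \<open>lam g\<close> and is by construction a generator of the next term.\<close>
  have "sb_star P C g x \<in> left_series P C (Suc i)"
    if "g \<in> carrier P" "x \<in> left_series P C i" for g x i
    using that by (auto simp: sb_star_set_def intro!: generate.incl)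
  then show ?thesis
    using assms lambda_action unfolding stable_action_def stable_action_axioms_def
    by (simp add: sb_star_def)
qed

lemma lambda_orbit_eq:
  "x \<in> carrier P \<Longrightarrow> orbit C (\<lambda>a. restrict (lam a) (carrier P)) x = lambda_orbit P C x"
  by (simp add: orbit_def lambda_orbit_def)

lemma theta_orbit_eq:
  assumes "x \<in> carrier P"
  defines "\<phi> \<equiv> \<lambda>a. restrict (lam a) (carrier P)"
  shows "orbit (semidirect P C \<phi>) (\<lambda>a. restrict (affine_act P \<phi> a) (carrier P)) x =
    theta_orbit P C x"
  using assms(1) by (auto simp: orbit_def theta_orbit_def semidirect_def affine_act_def \<phi>_def)

end

lemma orbit_vertices_cong:
  "(\<And>x. x \<in> A \<Longrightarrow> f x = g x) \<Longrightarrow> orbit_vertices A f = orbit_vertices A g"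
  unfolding orbit_vertices_def by auto

theorem mainTheorem4:
  fixes P C :: "'a monoid"
  assumes "skew_brace P C"
    and "finite (carrier P)"
    and "left_nilpotent P C"
    and "nilpotent_group P"
  shows "graph_connected (Lambda_graph_V P C) orbit_adj \<and> diameter_le_2 (Lambda_graph_V P C) orbit_adj
       \<and> graph_connected (Theta_graph_V P C) orbit_adj \<and> diameter_le_2 (Theta_graph_V P C) orbit_adj"
proof -
  interpret finite_skew_brace P C using assms(1,2) by unfold_locales
  obtain n where n: "left_series P C n = {\<one>\<^bsub>P\<^esub>}"
    using assms(3) unfolding left_nilpotent_def by blast
  \<comment> \<open>This one stable action yields both graphs: directly for Lambda, through the
    semidirect product for Theta.\<close>
  note stable = lambda_stable_action[OF n assms(4)]
  let ?\<phi> = "\<lambda>a. restrict (lam a) (carrier P)"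
  have "orbit_vertices (carrier P) (orbit C ?\<phi>) = Lambda_graph_V P C"
    by (rule orbit_vertices_cong) (rule lambda_orbit_eq)
  then have "diameter_le_2 (Lambda_graph_V P C) orbit_adj"
    using nilpotent_primary_action.orbit_graph_diameter_le_2
      [OF stable_action.primary_action[OF stable]] by simp
  moreover have "orbit_vertices (carrier P)
      (orbit (semidirect P C ?\<phi>) (\<lambda>a. restrict (affine_act P ?\<phi> a) (carrier P))) = Theta_graph_V P C"
    by (rule orbit_vertices_cong) (rule theta_orbit_eq)
  then have "diameter_le_2 (Theta_graph_V P C) orbit_adj"
    using nilpotent_primary_action.orbit_graph_diameter_le_2
      [OF stable_action.affine_primary_action[OF stable]] by simp
  ultimately show ?thesis by (simp add: graph_connected_if_diameter_le_2)
qed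

end
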